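(* Let $p=p(x,\theta)$ be a probability distribution over configurations $x$, normalized or unnormalized, depending on parameters $\theta=(\theta_1,\dots,\theta_m)$, and let $O=O(x,\theta)$ be a quantity depending on the configuration and the parameters. The following Monte Carlo estimator of the expectation $\langle O(x,\theta)\rangle_p$, $$\langle O(x,\theta)\rangle_p=\frac{\left\langle \frac{p}{\bot(p)}\,O(x,\theta)\right\rangle_{\bot(p)}}{\left\langle \frac{p}{\bot(p)}\right\rangle_{\bot(p)}},$$ is automatic differentiable to all order, and works for both normalized and unnormalized probability distributions $p$. That is, for every $n=(n_1,\dots,n_m)$ with $n_j=0,1,2,\dots$ (including $n=0$, the expectation itself), $$\bot\left(\nabla_\theta^{(n)}\,\frac{\left\langle \frac{p}{\bot(p)}\,O\right\rangle_{\bot(p)}}{\left\langle \frac{p}{\bot(p)}\right\rangle_{\bot(p)}}\right)\doteq\bot\left(\nabla_\theta^{(n)}\sum_{x\in\mathrm{all}}p\,\frac{O}{Z}\right).$$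
   Context: Notation. $\sum_{x\in\mathrm{all}}$ is the sum over all configurations $x$, and $Z=Z_\theta=\sum_{x\in\mathrm{all}}p(x,\theta)$ is the partition function (normalization factor), which need not equal $1$ and need not be known. The expectation is $\langle O\rangle_p=\sum_{x\in\mathrm{all}}p\,O/Z$. $\nabla_\theta^{(n)}$ is the mixed partial derivative of order $n_j$ in $\theta_j$, $j=1,\dots,m$. Detach function. $\bot$ is the formal operation with $\bot(y)=y$ in value and $\partial\bot(y)/\partial y=0$: it passes on the value of its argument but is treated as a constant under differentiation. It satisfies $f(\bot(y))=\bot(f(y))$, $\bot(\bot(y))=\bot(y)$, $\bot(y+z)=\bot(y)+\bot(z)$, $\bot(yz)=\bot(y)\bot(z)$. An outer $\bot$ applied to both sides of an equation means that the two sides are compared in numerical value only. An equality $f=g$ of expressions involving $\bot$ is understood as equality of values of the derivatives of every order, $\bot(f^{(n)})=\bot(g^{(n)})$ for $n=0,1,2,\dots$. Monte Carlo average. $\langle\cdot\rangle_{\bot(p)}$ is the average $\frac{1}{N_s}\sum_{x\in S(p)}(\cdot)$ over a set $S(p)$ of $N_s$ configurations sampled by Monte Carlo according to the probability distribution proportional to $p$ at the current parameter value; the sampling distribution $\bot(p)$ is a fixed background and is not involved in derivatives. The sign $\doteq$ means equality in the sense that the Monte Carlo estimation becomes exact in the limit of large $N_s$; for a quantity $f(x)$ this means $\frac{1}{N_s}\sum_{x\in S(p)}f(x)\doteq\sum_{x\in\mathrm{all}}\frac{\bot(p)}{\bot(Z)}f(x)$.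
   Formalization: Assumes p and O are smooth in θ, all θ-derivatives of p and pO are locally dominated by a summable function of x (automatic for finitely many x), and each x has p>0 at the current θ or p vanishing near it; the claim fails or is undefined otherwise. *)

theory Defs
  imports "HOL-Probability.Probability"
begin

text \<open>
  An expression built with the detach function is modelled by a function of two copies of the
  parameter: the first is the current parameter value, at which detached subexpressions are
  evaluated; the second is the variable of differentiation.  The numerical value at
  \<open>\<theta>\<close> is obtained on the diagonal, and derivatives are taken in the second argument only.
\<close>

type_synonym ('p, 'v) expr = "'p \<Rightarrow> 'p \<Rightarrow> 'v"

definition plain :: "('p \<Rightarrow> 'v) \<Rightarrow> ('p, 'v) expr" where
  "plain f = (\<lambda>\<phi> \<theta>. f \<theta>)"

definition detach :: "('p, 'v) expr \<Rightarrow> ('p, 'v) expr" where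
  "detach e = (\<lambda>\<phi> \<theta>. e \<phi> \<phi>)"

definition partial :: "'m::finite \<Rightarrow> (real^'m \<Rightarrow> real) \<Rightarrow> real^'m \<Rightarrow> real" where
  "partial j f = (\<lambda>\<theta>. deriv (\<lambda>t. f (\<theta> + t *\<^sub>R axis j 1)) 0)"

definition mixed_partial :: "'m::finite list \<Rightarrow> (real^'m \<Rightarrow> real) \<Rightarrow> real^'m \<Rightarrow> real" where
  "mixed_partial js f = foldr partial js f"

definition nabla :: "'m::finite list \<Rightarrow> (real^'m, real) expr \<Rightarrow> (real^'m, real) expr" where
  "nabla js e = (\<lambda>\<phi>. mixed_partial js (e \<phi>))"

lemma detach_value: "detach e \<theta> \<theta> = e \<theta> \<theta>"
  by (simp add: detach_def)

lemma detach_idem: "detach (detach e) = detach e"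
  by (simp add: detach_def)

lemma detach_apply: "detach (\<lambda>\<phi> \<theta>. f (e \<phi> \<theta>)) = (\<lambda>\<phi> \<theta>. f (detach e \<phi> \<theta>))"
  by (simp add: detach_def)

lemma detach_add:
  "detach (\<lambda>\<phi> \<theta>. d \<phi> \<theta> + e \<phi> \<theta>) = (\<lambda>\<phi> \<theta>. detach d \<phi> \<theta> + detach e \<phi> \<theta>)"
  by (simp add: detach_def)

lemma detach_mult:
  "detach (\<lambda>\<phi> \<theta>. d \<phi> \<theta> * e \<phi> \<theta>) = (\<lambda>\<phi> \<theta>. detach d \<phi> \<theta> * detach e \<phi> \<theta>)"
  by (simp add: detach_def)

lemma nabla_detach: "nabla [j] (detach e) = (\<lambda>\<phi> \<theta>. 0)"
  by (simp add: nabla_def mixed_partial_def partial_def detach_def)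

text \<open>
  Infinite differentiability on an open set: all iterated partial derivatives are (totally)
  differentiable, hence also continuous.
\<close>

definition smooth_on :: "(real^'m::finite) set \<Rightarrow> (real^'m \<Rightarrow> real) \<Rightarrow> bool" where
  "smooth_on S f \<longleftrightarrow> (\<forall>js. mixed_partial js f differentiable_on S)"

text \<open>
  The usual condition under which a sum over configurations may be differentiated term by term
  to every order.  It is automatic for smooth terms when there are only finitely many
  configurations.
\<close>

definition locally_dominated ::
    "(real^'m::finite) set \<Rightarrow> ('c \<Rightarrow> real^'m \<Rightarrow> real) \<Rightarrow> bool" where
  "locally_dominated S f \<longleftrightarrow>
    (\<forall>js. \<forall>\<theta>\<in>S. \<exists>U g. open U \<and> \<theta> \<in> U \<and> g summable_on UNIV \<and>
       (\<forall>x. \<forall>\<eta>\<in>U \<inter> S. \<bar>mixed_partial js (f x) \<eta>\<bar> \<le> g x))"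

definition partition_function :: "('c \<Rightarrow> 'p \<Rightarrow> real) \<Rightarrow> 'p \<Rightarrow> real" where
  "partition_function p \<theta> = (\<Sum>\<^sub>\<infinity>x. p x \<theta>)"

definition mean_value :: "('c \<Rightarrow> 'p \<Rightarrow> real) \<Rightarrow> ('c \<Rightarrow> 'p \<Rightarrow> real) \<Rightarrow> 'p \<Rightarrow> real" where
  "mean_value p Q \<theta> = (\<Sum>\<^sub>\<infinity>x. p x \<theta> * Q x \<theta> / partition_function p \<theta>)"

definition sample_average :: "nat \<Rightarrow> (nat \<Rightarrow> 'c) \<Rightarrow> ('c \<Rightarrow> real) \<Rightarrow> real" where
  "sample_average N s f = (\<Sum>i<N. f (s i)) / real N"

definition mc_exact :: "'w measure \<Rightarrow> (nat \<Rightarrow> 'w \<Rightarrow> real) \<Rightarrow> real \<Rightarrow> bool" where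
  "mc_exact M Y L \<longleftrightarrow> (AE \<omega> in M. (\<lambda>N. Y N \<omega>) \<longlonglongrightarrow> L)"

text \<open>
  Monte Carlo sampling from the distribution \<open>q\<close>: the samples need not be independent (they may
  come from an ergodic Markov chain).  The exceptional null set may depend on \<open>f\<close>.
\<close>

definition mc_sampling :: "'w measure \<Rightarrow> (nat \<Rightarrow> 'w \<Rightarrow> 'c) \<Rightarrow> ('c \<Rightarrow> real) \<Rightarrow> bool" where
  "mc_sampling M X q \<longleftrightarrow>
    prob_space M \<and>
    (\<forall>i. X i \<in> measurable M (count_space UNIV)) \<and>
    (\<forall>f. (\<lambda>x. q x * f x) summable_on UNIV \<longrightarrow>
       mc_exact M (\<lambda>N \<omega>. sample_average N (\<lambda>i. X i \<omega>) f) (\<Sum>\<^sub>\<infinity>x. q x * f x))"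

definition detached_ratio :: "('c \<Rightarrow> 'p \<Rightarrow> real) \<Rightarrow> 'c \<Rightarrow> ('p, real) expr" where
  "detached_ratio p x = (\<lambda>\<phi> \<theta>. plain (p x) \<phi> \<theta> / detach (plain (p x)) \<phi> \<theta>)"

definition mc_estimator ::
    "('c \<Rightarrow> 'p \<Rightarrow> real) \<Rightarrow> ('c \<Rightarrow> 'p \<Rightarrow> real) \<Rightarrow> nat \<Rightarrow> (nat \<Rightarrow> 'c) \<Rightarrow> ('p, real) expr" where
  "mc_estimator p Q N s = (\<lambda>\<phi> \<theta>.
     sample_average N s (\<lambda>x. detached_ratio p x \<phi> \<theta> * plain (Q x) \<phi> \<theta>) /
     sample_average N s (\<lambda>x. detached_ratio p x \<phi> \<theta>))"

end

theory Submission
  imports Defs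
begin

text \<open>
  With the sampling point \<open>\<theta>0\<close> frozen, numerator and denominator of the estimator are finite linear
  combinations of \<open>p x * Q x\<close> and \<open>p x\<close> with weights \<open>1 / p x \<theta>0\<close>.  Each mixed partial at \<open>\<theta>0\<close>
  is therefore a sample average, and it tends almost surely to the mixed partial of
  \<open>(\<Sum>\<^sub>\<infinity>x. p x \<theta> * Q x \<theta>) / Z0\<close> or of \<open>(\<Sum>\<^sub>\<infinity>x. p x \<theta>) / Z0\<close>, since domination allows
  differentiation under the sum; here \<open>Z0\<close> is the partition function at \<open>\<theta>0\<close>.  There are only
  countably many mixed partials, so off one null set all of them converge simultaneously.
  Convergence of all derivatives at a point passes to products and inverses, by induction on
  the order, hence to the quotient, where the constant \<open>Z0\<close> cancels.
\<close>

section \<open>Mixed partial derivatives on open sets\<close>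

text \<open>\<open>partial\<close> is built on \<open>deriv\<close>, which has a value even where no
  derivative exists. Where the total derivative exists, the chain rule along the line
  \<open>\<theta> + t *\<^sub>R axis j 1\<close> identifies the two, and all calculus rules below go
  through \<open>D\<close>.\<close>

lemma partial_eq_derivative:
  assumes "(f has_derivative D) (at \<theta>)"
  shows "partial j f \<theta> = D (axis j 1)"
proof -
  interpret D: bounded_linear D
    using assms by (rule has_derivative_bounded_linear)
  have "((\<lambda>t::real. f (\<theta> + t *\<^sub>R axis j 1)) has_derivative (\<lambda>t. D (t *\<^sub>R axis j 1))) (at 0)"
    by (rule has_derivative_compose[of "\<lambda>t. \<theta> + t *\<^sub>R axis j 1" "\<lambda>t. t *\<^sub>R axis j 1" 0 UNIV f D, simplified])
       (use assms in \<open>auto intro!: derivative_eq_intros\<close>)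
  then have "((\<lambda>t::real. f (\<theta> + t *\<^sub>R axis j 1)) has_real_derivative D (axis j 1)) (at 0)"
    by (simp add: has_field_derivative_def D.scaleR mult_commute_abs)
  then show ?thesis
    unfolding partial_def by (rule DERIV_imp_deriv)
qed

lemma partial_cong:
  assumes "open S" "\<theta> \<in> S" "\<And>\<eta>. \<eta> \<in> S \<Longrightarrow> f \<eta> = g \<eta>"
  shows "partial j f \<theta> = partial j g \<theta>"
  unfolding partial_def
proof (rule deriv_cong_ev)
  have "((\<lambda>t::real. \<theta> + t *\<^sub>R axis j 1) \<longlongrightarrow> \<theta> + 0 *\<^sub>R axis j 1) (nhds 0)"
    by (intro tendsto_intros filterlim_ident)
  then have "\<forall>\<^sub>F t::real in nhds 0. \<theta> + t *\<^sub>R axis j 1 \<in> S"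
    using assms(1,2) by (intro topological_tendstoD) auto
  then show "\<forall>\<^sub>F t in nhds 0. f (\<theta> + t *\<^sub>R axis j 1) = g (\<theta> + t *\<^sub>R axis j 1)"
    by eventually_elim (use assms(3) in auto)
qed simp

lemma mixed_partial_simps [simp]:
  "mixed_partial [] f = f"
  "mixed_partial (j # js) f = partial j (mixed_partial js f)"
  by (simp_all add: mixed_partial_def)

text \<open>The head of the list is the outermost derivative. Appending \<open>[j]\<close> therefore
  exposes the innermost one, which is what inductions based on the product and inverse rules
  need.\<close>

lemma mixed_partial_append:
  "mixed_partial (ks @ js) f = mixed_partial ks (mixed_partial js f)"
  by (simp add: mixed_partial_def)

text \<open>Agreement at \<theta> alone would not survive differentiation; the induction keeps it on
  all of the open set \<open>S\<close>, which contains a piece of every line through each of its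
  points.\<close>

lemma mixed_partial_cong:
  assumes "open S" "\<And>\<eta>. \<eta> \<in> S \<Longrightarrow> f \<eta> = g \<eta>" "\<theta> \<in> S"
  shows "mixed_partial js f \<theta> = mixed_partial js g \<theta>"
  using assms(3)
proof (induction js arbitrary: \<theta>)
  case (Cons j js)
  then show ?case
    unfolding mixed_partial_simps by (intro partial_cong[OF assms(1)])
qed (use assms in simp)

lemma differentiable_on_cong:
  assumes "f differentiable_on S" "\<And>\<eta>. \<eta> \<in> S \<Longrightarrow> f \<eta> = g \<eta>"
  shows "g differentiable_on S"
  unfolding differentiable_on_def
proof
  fix \<eta> assume "\<eta> \<in> S"
  then show "g differentiable at \<eta> within S"
    using assms differentiable_transform_within[of f \<eta> S 1 g]
    by (auto simp: differentiable_on_def)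
qed

lemma differentiable_onD_at:
  assumes "f differentiable_on S" "open S" "\<eta> \<in> S"
  obtains D where "(f has_derivative D) (at \<eta>)"
  using assms by (auto simp: differentiable_on_eq_differentiable_at differentiable_def)

lemma partial_lincomb:
  assumes "open S" "\<And>i. i \<in> I \<Longrightarrow> f i differentiable_on S" "\<theta> \<in> S"
  shows "partial j (\<lambda>\<eta>. \<Sum>i\<in>I. c i * f i \<eta>) \<theta> = (\<Sum>i\<in>I. c i * partial j (f i) \<theta>)"
proof -
  have "\<exists>D. (f i has_derivative D) (at \<theta>)" if "i \<in> I" for i
    using assms that by (meson differentiable_onD_at)
  then obtain D where D: "\<And>i. i \<in> I \<Longrightarrow> (f i has_derivative D i) (at \<theta>)"
    by metis
  have "((\<lambda>\<eta>. \<Sum>i\<in>I. c i * f i \<eta>) has_derivative (\<lambda>h. \<Sum>i\<in>I. c i * D i h)) (at \<theta>)"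
    by (intro has_derivative_sum has_derivative_mult_right D)
  then show ?thesis
    using D by (simp add: partial_eq_derivative[where D = "\<lambda>h. \<Sum>i\<in>I. c i * D i h"]
      partial_eq_derivative[OF D] cong: sum.cong)
qed

lemma partial_mult:
  assumes "open S" "f differentiable_on S" "g differentiable_on S" "\<theta> \<in> S"
  shows "partial j (\<lambda>\<eta>. f \<eta> * g \<eta>) \<theta> = partial j f \<theta> * g \<theta> + f \<theta> * partial j g \<theta>"
proof -
  obtain D E where D: "(f has_derivative D) (at \<theta>)" and E: "(g has_derivative E) (at \<theta>)"
    using assms by (meson differentiable_onD_at)
  show ?thesis
    unfolding partial_eq_derivative[OF has_derivative_mult[OF D E]] partial_eq_derivative[OF D]
      partial_eq_derivative[OF E] by simp
qed

lemma partial_inverse: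
  assumes "open S" "f differentiable_on S" "\<theta> \<in> S" "f \<theta> \<noteq> 0"
  shows "partial j (\<lambda>\<eta>. inverse (f \<eta>)) \<theta> = - (partial j f \<theta> * (inverse (f \<theta>) * inverse (f \<theta>)))"
proof -
  obtain D where D: "(f has_derivative D) (at \<theta>)"
    using assms by (meson differentiable_onD_at)
  show ?thesis
    unfolding partial_eq_derivative[OF Deriv.has_derivative_inverse[OF assms(4) D]] partial_eq_derivative[OF D]
    by (simp add: mult_ac)
qed

section \<open>Smoothness of sums, products and inverses\<close>

text \<open>A graded form of \<open>smooth_on\<close> that permits induction on the order: in the
  product and inverse rules the original functions reappear next to their derivatives, and only the
  order drops.\<close>

definition smooth_upto :: "nat \<Rightarrow> (real^'m::finite) set \<Rightarrow> (real^'m \<Rightarrow> real) \<Rightarrow> bool" where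
  "smooth_upto n S f \<longleftrightarrow> (\<forall>js. length js \<le> n \<longrightarrow> mixed_partial js f differentiable_on S)"

lemma smooth_on_iff_upto: "smooth_on S f \<longleftrightarrow> (\<forall>n. smooth_upto n S f)"
  by (auto simp: smooth_on_def smooth_upto_def)

lemma smooth_upto_mono: "smooth_upto n S f \<Longrightarrow> k \<le> n \<Longrightarrow> smooth_upto k S f"
  by (auto simp: smooth_upto_def)

lemma smooth_upto_0: "smooth_upto 0 S f \<longleftrightarrow> f differentiable_on S"
  by (simp add: smooth_upto_def)

lemma smooth_upto_Suc:
  fixes f :: "real^'m::finite \<Rightarrow> real"
  shows "smooth_upto (Suc n) S f \<longleftrightarrow> f differentiable_on S \<and> (\<forall>j. smooth_upto n S (partial j f))"
    (is "?L \<longleftrightarrow> ?R")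
proof
  assume L: ?L
  have "mixed_partial js (partial j f) differentiable_on S" if "length js \<le> n" for js and j :: 'm
  proof -
    have "mixed_partial (js @ [j]) f differentiable_on S"
      using L that unfolding smooth_upto_def by (metis Suc_le_mono length_append_singleton)
    then show ?thesis
      by (simp add: mixed_partial_append)
  qed
  moreover have "mixed_partial [] f differentiable_on S"
    using L unfolding smooth_upto_def by (metis list.size(3) zero_le)
  ultimately show ?R
    by (simp add: smooth_upto_def)
next
  assume R: ?R
  show ?L
    unfolding smooth_upto_def
  proof (intro allI impI)
    fix js :: "'m list" assume len: "length js \<le> Suc n"
    show "mixed_partial js f differentiable_on S"
    proof (cases js rule: rev_cases)
      case Nil
      with R show ?thesis by simp
    next
      case (snoc ks j)
      then have "mixed_partial ks (partial j f) differentiable_on S"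
        using R len by (simp add: smooth_upto_def)
      with snoc show ?thesis by (simp add: mixed_partial_append)
    qed
  qed
qed

lemma smooth_upto_cong:
  fixes f :: "real^'m::finite \<Rightarrow> real"
  assumes "open S" "\<And>\<eta>. \<eta> \<in> S \<Longrightarrow> f \<eta> = g \<eta>" "smooth_upto n S f"
  shows "smooth_upto n S g"
  unfolding smooth_upto_def
proof (intro allI impI)
  fix js :: "'m list" assume "length js \<le> n"
  then have "mixed_partial js f differentiable_on S"
    using assms(3) by (simp add: smooth_upto_def)
  then show "mixed_partial js g differentiable_on S"
    by (rule differentiable_on_cong) (rule mixed_partial_cong[OF assms(1)], simp_all add: assms(2))
qed

text \<open>The bound is \<open>Suc n\<close> because \<open>smooth_upto n\<close> makes the
  partials of order \<open>n\<close> differentiable, which leaves room for one more outermost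
  derivative.\<close>

lemma mixed_partial_lincomb_upto:
  assumes "open S" "\<And>i. i \<in> I \<Longrightarrow> smooth_upto n S (f i)" "length js \<le> Suc n" "\<theta> \<in> S"
  shows "mixed_partial js (\<lambda>\<eta>. \<Sum>i\<in>I. c i * f i \<eta>) \<theta> = (\<Sum>i\<in>I. c i * mixed_partial js (f i) \<theta>)"
  using assms(3,4)
proof (induction js arbitrary: \<theta>)
  case (Cons j js)
  have "mixed_partial (j # js) (\<lambda>\<eta>. \<Sum>i\<in>I. c i * f i \<eta>) \<theta>
      = partial j (\<lambda>\<eta>. \<Sum>i\<in>I. c i * mixed_partial js (f i) \<eta>) \<theta>"
    unfolding mixed_partial_simps using Cons by (intro partial_cong[OF assms(1)]) simp_all
  also have "\<dots> = (\<Sum>i\<in>I. c i * partial j (mixed_partial js (f i)) \<theta>)"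
    using Cons.prems assms(2) by (intro partial_lincomb[OF assms(1)]) (auto simp: smooth_upto_def)
  finally show ?case by simp
qed simp

lemma smooth_upto_lincomb:
  fixes f :: "'i \<Rightarrow> real^'m::finite \<Rightarrow> real"
  assumes "open S" "finite I" "\<And>i. i \<in> I \<Longrightarrow> smooth_upto n S (f i)"
  shows "smooth_upto n S (\<lambda>\<eta>. \<Sum>i\<in>I. c i * f i \<eta>)"
  unfolding smooth_upto_def
proof (intro allI impI)
  fix js :: "'m list" assume len: "length js \<le> n"
  have "(\<lambda>\<eta>. \<Sum>i\<in>I. c i * mixed_partial js (f i) \<eta>) differentiable_on S"
    using assms(2,3) len unfolding differentiable_on_def smooth_upto_def
    by (intro ballI differentiable_sum differentiable_mult differentiable_const) auto
  then show "mixed_partial js (\<lambda>\<eta>. \<Sum>i\<in>I. c i * f i \<eta>) differentiable_on S"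
    by (rule differentiable_on_cong)
       (use assms len mixed_partial_lincomb_upto[of S I n f js] in auto)
qed

lemma smooth_upto_add:
  assumes "open S" "smooth_upto n S f" "smooth_upto n S g"
  shows "smooth_upto n S (\<lambda>\<eta>. f \<eta> + g \<eta>)"
  \<comment> \<open>A sum of two functions is treated as a linear combination indexed by
    \<open>bool\<close> with both weights 1.\<close>
  using smooth_upto_lincomb[OF assms(1), of "UNIV :: bool set" n "\<lambda>b. if b then f else g" "\<lambda>_. 1"] assms(2,3)
  by (simp add: UNIV_bool add.commute)

lemma smooth_upto_uminus:
  assumes "open S" "smooth_upto n S f"
  shows "smooth_upto n S (\<lambda>\<eta>. - f \<eta>)"
  using smooth_upto_lincomb[OF assms(1), of "{()}" n "\<lambda>_. f" "\<lambda>_. - 1"] assms(2) by simp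

text \<open>By the product rule each partial of the product is a sum of two products with factors
  smooth to order \<open>n\<close>, so the induction hypothesis applies to both. The rule holds only
  on \<open>S\<close>, hence the transfer by \<open>smooth_upto_cong\<close>.\<close>

lemma smooth_upto_mult:
  assumes "open S" "smooth_upto n S f" "smooth_upto n S g"
  shows "smooth_upto n S (\<lambda>\<eta>. f \<eta> * g \<eta>)"
  using assms(2,3)
proof (induction n arbitrary: f g)
  case (Suc n)
  have fg: "f differentiable_on S" "g differentiable_on S" "smooth_upto n S f" "smooth_upto n S g"
    "\<And>j. smooth_upto n S (partial j f)" "\<And>j. smooth_upto n S (partial j g)"
    using Suc.prems smooth_upto_mono[OF Suc.prems(1), of n] smooth_upto_mono[OF Suc.prems(2), of n]
    by (auto simp: smooth_upto_Suc)
  have "smooth_upto n S (partial j (\<lambda>\<eta>. f \<eta> * g \<eta>))" for j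
    using smooth_upto_add[OF assms(1) Suc.IH Suc.IH, OF fg(5,4) fg(3,6)]
    by (rule smooth_upto_cong[OF assms(1), rotated]) (simp add: partial_mult[OF assms(1)] fg)
  then show ?case
    using fg by (simp add: smooth_upto_Suc)
qed (simp add: smooth_upto_0)

text \<open>The derivative of \<open>1/f\<close> contains \<open>1/f\<close> again, but only to
  order \<open>n\<close>, where the induction hypothesis covers it; products are already
  available.\<close>

lemma smooth_upto_inverse:
  assumes "open S" "smooth_upto n S f" "\<And>\<eta>. \<eta> \<in> S \<Longrightarrow> f \<eta> \<noteq> 0"
  shows "smooth_upto n S (\<lambda>\<eta>. inverse (f \<eta>))"
  using assms(2)
proof (induction n)
  case (Suc n)
  have f: "f differentiable_on S" "smooth_upto n S f" "\<And>j. smooth_upto n S (partial j f)"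
    using Suc.prems smooth_upto_mono[OF Suc.prems, of n] by (auto simp: smooth_upto_Suc)
  note mult = smooth_upto_mult[OF assms(1)]
  have "smooth_upto n S (partial j (\<lambda>\<eta>. inverse (f \<eta>)))" for j
    using smooth_upto_uminus[OF assms(1) mult[OF f(3) mult[OF Suc.IH Suc.IH, OF f(2,2)]]]
    by (rule smooth_upto_cong[OF assms(1), rotated]) (simp add: partial_inverse[OF assms(1)] f assms(3))
  then show ?case
    using f assms(3) by (simp add: smooth_upto_Suc)
qed (simp add: smooth_upto_0 assms(3))

section \<open>From every finite order to infinite differentiability\<close>

lemma smooth_on_differentiable: "smooth_on S f \<Longrightarrow> f differentiable_on S"
  unfolding smooth_on_def by (drule spec[of _ "[]"]) simp

lemma smooth_on_subset: "smooth_on S f \<Longrightarrow> T \<subseteq> S \<Longrightarrow> smooth_on T f"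
  unfolding smooth_on_def by (meson differentiable_on_subset)

lemma smooth_on_partial: "smooth_on S f \<Longrightarrow> smooth_on S (partial j f)"
  unfolding smooth_on_iff_upto using smooth_upto_Suc by blast

lemma smooth_on_lincomb:
  "open S \<Longrightarrow> finite I \<Longrightarrow> (\<And>i. i \<in> I \<Longrightarrow> smooth_on S (f i)) \<Longrightarrow>
    smooth_on S (\<lambda>\<eta>. \<Sum>i\<in>I. c i * f i \<eta>)"
  by (simp add: smooth_on_iff_upto smooth_upto_lincomb)

lemma smooth_on_mult:
  "open S \<Longrightarrow> smooth_on S f \<Longrightarrow> smooth_on S g \<Longrightarrow> smooth_on S (\<lambda>\<eta>. f \<eta> * g \<eta>)"
  by (simp add: smooth_on_iff_upto smooth_upto_mult)

lemma smooth_on_inverse: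
  "open S \<Longrightarrow> smooth_on S f \<Longrightarrow> (\<And>\<eta>. \<eta> \<in> S \<Longrightarrow> f \<eta> \<noteq> 0) \<Longrightarrow> smooth_on S (\<lambda>\<eta>. inverse (f \<eta>))"
  by (simp add: smooth_on_iff_upto smooth_upto_inverse)

lemma mixed_partial_lincomb:
  assumes "open S" "\<And>i. i \<in> I \<Longrightarrow> smooth_on S (f i)" "\<theta> \<in> S"
  shows "mixed_partial js (\<lambda>\<eta>. \<Sum>i\<in>I. c i * f i \<eta>) \<theta> = (\<Sum>i\<in>I. c i * mixed_partial js (f i) \<theta>)"
  by (rule mixed_partial_lincomb_upto[OF assms(1), where n = "length js"])
     (use assms in \<open>auto simp: smooth_on_iff_upto\<close>)

section \<open>Differentiating a sum over configurations term by term\<close>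

text \<open>The difference quotient errors of the terms are dominated by a multiple of
  \<open>\<bar>g x\<bar>\<close>, so their sum converges uniformly on \<open>U\<close> and the limit
  \<eta> to \<theta> may be taken inside it. Convexity of \<open>U\<close> serves the mean value
  inequality.\<close>

lemma has_derivative_infsum:
  fixes G :: "'c \<Rightarrow> 'a::real_normed_vector \<Rightarrow> real"
  assumes "open U" "convex U" "\<theta> \<in> U"
    and deriv: "\<And>x \<eta>. \<eta> \<in> U \<Longrightarrow> (G x has_derivative D x \<eta>) (at \<eta>)"
    and bound: "\<And>x \<eta> h. \<eta> \<in> U \<Longrightarrow> \<bar>D x \<eta> h\<bar> \<le> g x * norm h"
    and g: "g summable_on UNIV"
    and G: "\<And>\<eta>. \<eta> \<in> U \<Longrightarrow> (\<lambda>x. G x \<eta>) summable_on UNIV"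
  shows "((\<lambda>\<eta>. \<Sum>\<^sub>\<infinity>x. G x \<eta>) has_derivative (\<lambda>h. \<Sum>\<^sub>\<infinity>x. D x \<theta> h)) (at \<theta>)"
proof -
  have summable_of_bound: "f summable_on UNIV" if "\<And>x. \<bar>f x\<bar> \<le> c * g x" for f :: "'c \<Rightarrow> real" and c
  proof (rule abs_summable_summable)
    show "(\<lambda>x. norm (f x)) summable_on UNIV"
      using summable_on_cmult_right[OF g, of c]
      by (rule Infinite_Sum.abs_summable_on_comparison_test') (simp add: that)
  qed
  have D: "(\<lambda>x. D x \<theta> h) summable_on UNIV" for h
    using bound[OF assms(3), of _ h] by (intro summable_of_bound[of _ "norm h"]) (simp add: mult.commute)
  have lin: "linear (D x \<theta>)" for x
    using deriv[OF assms(3)] has_derivative_linear by blast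
  have D_bl: "bounded_linear (\<lambda>h. \<Sum>\<^sub>\<infinity>x. D x \<theta> h)"
  proof (rule bounded_linear_intro)
    show "(\<Sum>\<^sub>\<infinity>x. D x \<theta> (a + b)) = (\<Sum>\<^sub>\<infinity>x. D x \<theta> a) + (\<Sum>\<^sub>\<infinity>x. D x \<theta> b)" for a b
      by (simp add: linear_add[OF lin] infsum_add D)
    show "(\<Sum>\<^sub>\<infinity>x. D x \<theta> (r *\<^sub>R a)) = r *\<^sub>R (\<Sum>\<^sub>\<infinity>x. D x \<theta> a)" for r a
      by (simp add: linear_scale[OF lin] infsum_cmult_right')
    show "norm (\<Sum>\<^sub>\<infinity>x. D x \<theta> h) \<le> norm h * (\<Sum>\<^sub>\<infinity>x. g x)" for h
    proof (rule norm_infsum_le)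
      show "((\<lambda>x. D x \<theta> h) has_sum (\<Sum>\<^sub>\<infinity>x. D x \<theta> h)) UNIV"
        using D by (rule has_sum_infsum)
      show "((\<lambda>x. norm h * g x) has_sum (norm h * (\<Sum>\<^sub>\<infinity>x. g x))) UNIV"
        using g by (intro has_sum_cmult_right has_sum_infsum)
    qed (use bound[OF assms(3)] in \<open>simp add: mult.commute\<close>)
  qed
  \<comment> \<open>The first-order remainder divided by the distance; at
    \<open>\<eta> = \<theta>\<close> it is 0 by the convention \<open>a / 0 = 0\<close>.\<close>
  define r where "r x \<eta> = (G x \<eta> - G x \<theta> - D x \<theta> (\<eta> - \<theta>)) / norm (\<eta> - \<theta>)" for x \<eta>
  \<comment> \<open>One \<open>\<bar>g x\<bar>\<close> comes from the mean value inequality for the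
    increment, the other from the linear term. The absolute value is taken because
    \<open>bound\<close> forces \<open>g x \<ge> 0\<close> only if the space has a nonzero
    vector.\<close>
  have r_bound: "\<bar>r x \<eta>\<bar> \<le> 2 * \<bar>g x\<bar>" if "\<eta> \<in> U" for x \<eta>
  proof (cases "\<eta> = \<theta>")
    case True
    then show ?thesis by (simp add: r_def)
  next
    case False
    have "norm (G x \<eta> - G x \<theta>) \<le> \<bar>g x\<bar> * norm (\<eta> - \<theta>)"
    proof (rule differentiable_bound[OF assms(2) _ _ that assms(3)])
      show "(G x has_derivative D x \<zeta>) (at \<zeta> within U)" if "\<zeta> \<in> U" for \<zeta>
        using deriv[OF that] by (rule has_derivative_at_withinI)
      show "onorm (D x \<zeta>) \<le> \<bar>g x\<bar>" if "\<zeta> \<in> U" for \<zeta>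
      proof (rule onorm_bound)
        show "norm (D x \<zeta> h) \<le> \<bar>g x\<bar> * norm h" for h
          using bound[OF that, of x h] mult_right_mono[OF abs_ge_self, of "norm h" "g x"] by simp
      qed simp
    qed
    moreover have "\<bar>D x \<theta> (\<eta> - \<theta>)\<bar> \<le> \<bar>g x\<bar> * norm (\<eta> - \<theta>)"
      using bound[OF assms(3), of x "\<eta> - \<theta>"] mult_right_mono[OF abs_ge_self, of "norm (\<eta> - \<theta>)" "g x"]
      by simp
    ultimately have "\<bar>G x \<eta> - G x \<theta> - D x \<theta> (\<eta> - \<theta>)\<bar> \<le> 2 * \<bar>g x\<bar> * norm (\<eta> - \<theta>)"
      unfolding real_norm_def by linarith
    with False show ?thesis
      by (simp add: r_def divide_le_eq)
  qed
  \<comment> \<open>Weierstrass M-test along the net of finite sets of configurations, with majorant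
    \<open>2 * \<bar>g x\<bar>\<close>.\<close>
  have unif: "uniform_limit U (\<lambda>F \<eta>. \<Sum>x\<in>F. r x \<eta>) (\<lambda>\<eta>. \<Sum>\<^sub>\<infinity>x. r x \<eta>) (finite_subsets_at_top UNIV)"
    using r_bound g
    by (intro Weierstrass_m_test_general[where M = "\<lambda>x. 2 * \<bar>g x\<bar>"])
      (auto simp: summable_on_iff_abs_summable_on_real[of g] intro!: summable_on_cmult_right)
  have r0: "(r x \<longlongrightarrow> 0) (at \<theta> within U)" for x
    using has_derivative_at_withinI[OF deriv[OF assms(3), of x], of U]
    unfolding has_derivative_at_within by (simp add: r_def[abs_def] divide_inverse mult.commute)
  have "((\<lambda>\<eta>. \<Sum>\<^sub>\<infinity>x. r x \<eta>) \<longlongrightarrow> 0) (at \<theta> within U)"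
    by (rule swap_uniform_limit[OF _ tendsto_const unif]) (auto intro!: tendsto_null_sum r0)
  moreover
  have "(\<Sum>\<^sub>\<infinity>x. r x \<eta>)
      = ((\<Sum>\<^sub>\<infinity>x. G x \<eta>) - (\<Sum>\<^sub>\<infinity>x. G x \<theta>) - (\<Sum>\<^sub>\<infinity>x. D x \<theta> (\<eta> - \<theta>))) /\<^sub>R norm (\<eta> - \<theta>)"
    (is "_ = ?q \<eta>") if "\<eta> \<in> U" for \<eta>
  proof -
    have "((\<lambda>x. G x \<eta> - G x \<theta> - D x \<theta> (\<eta> - \<theta>)) has_sum
        ((\<Sum>\<^sub>\<infinity>x. G x \<eta>) - (\<Sum>\<^sub>\<infinity>x. G x \<theta>) - (\<Sum>\<^sub>\<infinity>x. D x \<theta> (\<eta> - \<theta>)))) UNIV"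
      using G that assms(3) D unfolding diff_conv_add_uminus
      by (intro has_sum_add has_sum_uminusI has_sum_infsum)
    then have "(\<Sum>\<^sub>\<infinity>x. G x \<eta> - G x \<theta> - D x \<theta> (\<eta> - \<theta>))
        = (\<Sum>\<^sub>\<infinity>x. G x \<eta>) - (\<Sum>\<^sub>\<infinity>x. G x \<theta>) - (\<Sum>\<^sub>\<infinity>x. D x \<theta> (\<eta> - \<theta>))"
      by (rule infsumI)
    then show ?thesis
      by (simp add: r_def divide_inverse infsum_cmult_left')
  qed
  then have "\<forall>\<^sub>F \<eta> in at \<theta> within U. (\<Sum>\<^sub>\<infinity>x. r x \<eta>) = ?q \<eta>"
    by (simp add: eventually_at_filter)
  ultimately have "(?q \<longlongrightarrow> 0) (at \<theta> within U)"
    by (rule Lim_transform_eventually)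
  then have "((\<lambda>\<eta>. \<Sum>\<^sub>\<infinity>x. G x \<eta>) has_derivative (\<lambda>h. \<Sum>\<^sub>\<infinity>x. D x \<theta> h)) (at \<theta> within U)"
    using D_bl by (simp add: has_derivative_at_within)
  then show ?thesis
    unfolding at_within_open[OF assms(3,1)] .
qed

text \<open>Links domination, which concerns partial derivatives, with the bound on total
  derivatives needed for termwise differentiation: expand \<open>h\<close> in the axis basis and
  bound each coordinate by \<open>norm h\<close>.\<close>

lemma abs_derivative_le_partials:
  fixes G :: "real^'m::finite \<Rightarrow> real"
  assumes "(G has_derivative D) (at \<eta>)" and "\<And>j. \<bar>partial j G \<eta>\<bar> \<le> b j"
  shows "\<bar>D h\<bar> \<le> (\<Sum>j\<in>UNIV. b j) * norm h"
proof -
  have lin: "linear D"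
    using assms(1) by (rule has_derivative_linear)
  have "D h = D (\<Sum>j\<in>UNIV. h $ j *\<^sub>R axis j 1)"
    using basis_expansion[of h] by (simp add: scalar_mult_eq_scaleR)
  also have "\<dots> = (\<Sum>j\<in>UNIV. h $ j * partial j G \<eta>)"
    by (simp add: linear_sum[OF lin] linear_scale[OF lin] partial_eq_derivative[OF assms(1)])
  also have "\<bar>\<dots>\<bar> \<le> (\<Sum>j\<in>UNIV. \<bar>h $ j * partial j G \<eta>\<bar>)"
    by (rule sum_abs)
  also have "\<dots> \<le> (\<Sum>j\<in>UNIV. norm h * b j)"
    using assms(2) by (intro sum_mono) (auto simp: abs_mult component_le_norm_cart intro!: mult_mono)
  finally show ?thesis
    by (simp add: sum_distrib_left mult.commute)
qed

lemma summable_on_sum: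
  fixes g :: "'i \<Rightarrow> 'c \<Rightarrow> real"
  assumes "\<And>i. i \<in> I \<Longrightarrow> g i summable_on A"
  shows "(\<lambda>x. \<Sum>i\<in>I. g i x) summable_on A"
  using assms by (induction I rule: infinite_finite_induct) (simp_all add: summable_on_add)

lemma locally_dominated_summable:
  assumes "locally_dominated S f" "\<eta> \<in> S"
  shows "(\<lambda>x. mixed_partial js (f x) \<eta>) summable_on UNIV"
proof -
  obtain U g where "\<eta> \<in> U" "g summable_on UNIV" "\<forall>x. \<forall>\<zeta>\<in>U \<inter> S. \<bar>mixed_partial js (f x) \<zeta>\<bar> \<le> g x"
    using assms unfolding locally_dominated_def by meson
  with assms(2) have "(\<lambda>x. norm (mixed_partial js (f x) \<eta>)) summable_on UNIV"
    by (intro Infinite_Sum.abs_summable_on_comparison_test'[of g]) simp_all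
  then show ?thesis
    by (rule abs_summable_summable)
qed

text \<open>Domination of the order \<open>j # js\<close> gives a neighbourhood and a majorant for
  each \<open>j\<close>. There are finitely many directions, so a ball inside all the neighbourhoods
  and the sum of the majorants serve them together. The total derivative \<open>D\<close> yields
  smoothness of the sum, its values on the axes yield the partials.\<close>

lemma has_derivative_infsum_dominated:
  fixes f :: "'c \<Rightarrow> real^'m::finite \<Rightarrow> real"
  assumes "open S" "\<And>x. smooth_on S (f x)" "locally_dominated S f" "\<theta> \<in> S"
  shows "\<exists>D. ((\<lambda>\<eta>. \<Sum>\<^sub>\<infinity>x. mixed_partial js (f x) \<eta>) has_derivative D) (at \<theta>) \<and>
    (\<forall>j. D (axis j 1) = (\<Sum>\<^sub>\<infinity>x. mixed_partial (j # js) (f x) \<theta>))"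
proof -
  define G where "G x = mixed_partial js (f x)" for x
  have "\<forall>j. \<exists>U g. open U \<and> \<theta> \<in> U \<and> g summable_on UNIV \<and>
      (\<forall>x. \<forall>\<eta>\<in>U \<inter> S. \<bar>partial j (G x) \<eta>\<bar> \<le> g x)"
  proof
    fix j
    show "\<exists>U g. open U \<and> \<theta> \<in> U \<and> g summable_on UNIV \<and>
        (\<forall>x. \<forall>\<eta>\<in>U \<inter> S. \<bar>partial j (G x) \<eta>\<bar> \<le> g x)"
      using assms(3)[unfolded locally_dominated_def, rule_format, OF assms(4), of "j # js"]
      by (simp only: G_def mixed_partial_simps)
  qed
  from choice[OF this] obtain V where "\<forall>j. \<exists>g. open (V j) \<and> \<theta> \<in> V j \<and> g summable_on UNIV \<and>
      (\<forall>x. \<forall>\<eta>\<in>V j \<inter> S. \<bar>partial j (G x) \<eta>\<bar> \<le> g x)" ..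
  from choice[OF this] obtain g where "\<forall>j. open (V j) \<and> \<theta> \<in> V j \<and> g j summable_on UNIV \<and>
      (\<forall>x. \<forall>\<eta>\<in>V j \<inter> S. \<bar>partial j (G x) \<eta>\<bar> \<le> g j x)" ..
  then have V: "\<And>j. open (V j)" "\<And>j. \<theta> \<in> V j" "\<And>j. g j summable_on UNIV"
    "\<And>j x \<eta>. \<eta> \<in> V j \<inter> S \<Longrightarrow> \<bar>partial j (G x) \<eta>\<bar> \<le> g j x"
    by simp_all
  have "open (S \<inter> (\<Inter>j. V j))"
    using V(1) by (intro open_Int assms(1) open_INT) simp_all
  moreover have "\<theta> \<in> S \<inter> (\<Inter>j. V j)"
    using V(2) assms(4) by simp
  ultimately obtain e where e: "e > 0" "ball \<theta> e \<subseteq> S \<inter> (\<Inter>j. V j)"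
    by (rule openE)
  define B where "B = ball \<theta> e"
  have B: "\<eta> \<in> S" "\<eta> \<in> V j" if "\<eta> \<in> B" for \<eta> j
    using e that by (auto simp: B_def)
  define D where "D x \<eta> = frechet_derivative (G x) (at \<eta>)" for x \<eta>
  have D: "(G x has_derivative D x \<eta>) (at \<eta>)" if "\<eta> \<in> S" for x \<eta>
  proof -
    have "G x differentiable_on S"
      using assms(2)[of x] by (simp add: G_def smooth_on_def)
    then show ?thesis
      using that assms(1)
      by (simp add: D_def differentiable_on_eq_differentiable_at frechet_derivative_works[symmetric])
  qed
  have "((\<lambda>\<eta>. \<Sum>\<^sub>\<infinity>x. G x \<eta>) has_derivative (\<lambda>h. \<Sum>\<^sub>\<infinity>x. D x \<theta> h)) (at \<theta>)"
  proof (rule has_derivative_infsum[of B \<theta> G D "\<lambda>x. \<Sum>j\<in>UNIV. g j x"])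
    show "\<bar>D x \<eta> h\<bar> \<le> (\<Sum>j\<in>UNIV. g j x) * norm h" if "\<eta> \<in> B" for x \<eta> h
      by (rule abs_derivative_le_partials[OF D[OF B(1)[OF that]]]) (intro V(4) IntI B that)
    show "(\<lambda>x. \<Sum>j\<in>UNIV. g j x) summable_on UNIV"
      by (rule summable_on_sum) (rule V(3))
    show "(\<lambda>x. G x \<eta>) summable_on UNIV" if "\<eta> \<in> B" for \<eta>
      unfolding G_def using assms(3) B(1)[OF that] by (rule locally_dominated_summable)
    show "\<theta> \<in> B" "open B" "convex B"
      using e(1) by (simp_all add: B_def)
    show "(G x has_derivative D x \<eta>) (at \<eta>)" if "\<eta> \<in> B" for x \<eta>
      by (rule D[OF B(1)[OF that]])
  qed
  then have deriv: "((\<lambda>\<eta>. \<Sum>\<^sub>\<infinity>x. mixed_partial js (f x) \<eta>) has_derivative (\<lambda>h. \<Sum>\<^sub>\<infinity>x. D x \<theta> h)) (at \<theta>)"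
    by (simp only: G_def)
  have "D x \<theta> (axis j 1) = mixed_partial (j # js) (f x) \<theta>" for x j
    using partial_eq_derivative[OF D[OF assms(4)], of j x] by (simp only: G_def mixed_partial_simps)
  then have "\<forall>j. (\<Sum>\<^sub>\<infinity>x. D x \<theta> (axis j 1)) = (\<Sum>\<^sub>\<infinity>x. mixed_partial (j # js) (f x) \<theta>)"
    by simp
  with deriv show ?thesis
    by (intro exI[of _ "\<lambda>h. \<Sum>\<^sub>\<infinity>x. D x \<theta> h"] conjI)
qed

lemma mixed_partial_infsum:
  fixes f :: "'c \<Rightarrow> real^'m::finite \<Rightarrow> real"
  assumes "open S" "\<And>x. smooth_on S (f x)" "locally_dominated S f" "\<theta> \<in> S"
  shows "mixed_partial js (\<lambda>\<eta>. \<Sum>\<^sub>\<infinity>x. f x \<eta>) \<theta> = (\<Sum>\<^sub>\<infinity>x. mixed_partial js (f x) \<theta>)"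
  using assms(4)
proof (induction js arbitrary: \<theta>)
  case (Cons j js)
  obtain D where D: "((\<lambda>\<eta>. \<Sum>\<^sub>\<infinity>x. mixed_partial js (f x) \<eta>) has_derivative D) (at \<theta>)"
    "\<And>i. D (axis i 1) = (\<Sum>\<^sub>\<infinity>x. mixed_partial (i # js) (f x) \<theta>)"
    using has_derivative_infsum_dominated[where f = f, OF assms(1-3) Cons.prems, of js] by blast
  \<comment> \<open>The induction hypothesis holds on all of \<open>S\<close>, so it can be used
    underneath the outermost derivative.\<close>
  have "partial j (mixed_partial js (\<lambda>\<eta>. \<Sum>\<^sub>\<infinity>x. f x \<eta>)) \<theta> = partial j (\<lambda>\<eta>. \<Sum>\<^sub>\<infinity>x. mixed_partial js (f x) \<eta>) \<theta>"
    by (rule partial_cong[OF assms(1) Cons.prems]) (rule Cons.IH)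
  also have "\<dots> = D (axis j 1)"
    by (rule partial_eq_derivative[OF D(1)])
  finally show ?case
    unfolding D(2) mixed_partial_simps .
qed simp

lemma smooth_on_infsum:
  fixes f :: "'c \<Rightarrow> real^'m::finite \<Rightarrow> real"
  assumes "open S" "\<And>x. smooth_on S (f x)" "locally_dominated S f"
  shows "smooth_on S (\<lambda>\<eta>. \<Sum>\<^sub>\<infinity>x. f x \<eta>)"
  unfolding smooth_on_def
proof
  fix js
  have "(\<lambda>\<eta>. \<Sum>\<^sub>\<infinity>x. mixed_partial js (f x) \<eta>) differentiable_on S"
    unfolding differentiable_on_eq_differentiable_at[OF assms(1)] differentiable_def
    using has_derivative_infsum_dominated[where f = f, OF assms] by blast
  then show "mixed_partial js (\<lambda>\<eta>. \<Sum>\<^sub>\<infinity>x. f x \<eta>) differentiable_on S"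
    by (rule differentiable_on_cong) (rule mixed_partial_infsum[where f = f, OF assms, symmetric])
qed

section \<open>Convergence of all derivatives at a point\<close>

text \<open>A separate neighbourhood for each function: estimators of different samples have
  denominators with different zeros, so no common neighbourhood is at hand.\<close>

definition smooth_near :: "real^'m::finite \<Rightarrow> (real^'m \<Rightarrow> real) \<Rightarrow> bool" where
  "smooth_near \<theta> f \<longleftrightarrow> (\<exists>U. open U \<and> \<theta> \<in> U \<and> smooth_on U f)"

lemma smooth_nearI: "open U \<Longrightarrow> \<theta> \<in> U \<Longrightarrow> smooth_on U f \<Longrightarrow> smooth_near \<theta> f"
  by (auto simp: smooth_near_def)

lemma smooth_near_common:
  assumes "smooth_near \<theta> f" "smooth_near \<theta> g"
  obtains U where "open U" "\<theta> \<in> U" "smooth_on U f" "smooth_on U g"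
proof -
  obtain U V where "open U" "\<theta> \<in> U" "smooth_on U f" "open V" "\<theta> \<in> V" "smooth_on V g"
    using assms by (auto simp: smooth_near_def)
  then show thesis
    by (intro that[of "U \<inter> V"]) (auto intro: smooth_on_subset)
qed

lemma smooth_near_partial: "smooth_near \<theta> f \<Longrightarrow> smooth_near \<theta> (partial j f)"
  unfolding smooth_near_def by (meson smooth_on_partial)

lemma smooth_near_mult:
  assumes "smooth_near \<theta> f" "smooth_near \<theta> g"
  shows "smooth_near \<theta> (\<lambda>\<eta>. f \<eta> * g \<eta>)"
  using assms by (rule smooth_near_common) (blast intro: smooth_nearI smooth_on_mult)

text \<open>A smooth function is continuous, so the set where it does not vanish is open.\<close>

lemma smooth_near_nonzero:
  assumes "smooth_near \<theta> f" "f \<theta> \<noteq> 0"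
  obtains U where "open U" "\<theta> \<in> U" "smooth_on U f" "\<And>\<eta>. \<eta> \<in> U \<Longrightarrow> f \<eta> \<noteq> 0"
proof -
  obtain V where V: "open V" "\<theta> \<in> V" "smooth_on V f"
    using assms by (auto simp: smooth_near_def)
  have "continuous_on V f"
    using V by (intro differentiable_imp_continuous_on smooth_on_differentiable)
  then have "open (V \<inter> f -` (- {0}))"
    using V by (intro continuous_open_preimage) auto
  with V assms(2) show thesis
    by (intro that[of "V \<inter> f -` (- {0})"]) (auto intro: smooth_on_subset)
qed

lemma smooth_near_inverse:
  assumes "smooth_near \<theta> f" "f \<theta> \<noteq> 0"
  shows "smooth_near \<theta> (\<lambda>\<eta>. inverse (f \<eta>))"
  using assms by (rule smooth_near_nonzero) (blast intro: smooth_nearI smooth_on_inverse)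

text \<open>The product rule under further derivatives: it holds on a whole neighbourhood of
  \<theta>, hence may be differentiated there before evaluating at \<theta>.\<close>

lemma mixed_partial_partial_mult:
  assumes "smooth_near \<theta> f" "smooth_near \<theta> g"
  shows "mixed_partial js (partial j (\<lambda>\<eta>. f \<eta> * g \<eta>)) \<theta> =
    mixed_partial js (\<lambda>\<eta>. partial j f \<eta> * g \<eta>) \<theta> + mixed_partial js (\<lambda>\<eta>. f \<eta> * partial j g \<eta>) \<theta>"
proof -
  obtain U where U: "open U" "\<theta> \<in> U" "smooth_on U f" "smooth_on U g"
    using assms by (rule smooth_near_common)
  have smooth: "smooth_on U (\<lambda>\<eta>. partial j f \<eta> * g \<eta>)" "smooth_on U (\<lambda>\<eta>. f \<eta> * partial j g \<eta>)"
    using U by (auto intro: smooth_on_mult smooth_on_partial)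
  have "mixed_partial js (partial j (\<lambda>\<eta>. f \<eta> * g \<eta>)) \<theta> =
      mixed_partial js (\<lambda>\<eta>. partial j f \<eta> * g \<eta> + f \<eta> * partial j g \<eta>) \<theta>"
    using U by (intro mixed_partial_cong[OF U(1)]) (auto intro!: partial_mult[OF U(1)] smooth_on_differentiable)
  also have "\<dots> = mixed_partial js (\<lambda>\<eta>. partial j f \<eta> * g \<eta>) \<theta>
      + mixed_partial js (\<lambda>\<eta>. f \<eta> * partial j g \<eta>) \<theta>"
    using mixed_partial_lincomb[OF U(1), of UNIV
        "\<lambda>b. if b then (\<lambda>\<eta>. partial j f \<eta> * g \<eta>) else (\<lambda>\<eta>. f \<eta> * partial j g \<eta>)" \<theta> js "\<lambda>_. 1"]
      smooth U(2) by (simp add: UNIV_bool add.commute)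
  finally show ?thesis .
qed

lemma mixed_partial_partial_inverse:
  assumes "smooth_near \<theta> f" "f \<theta> \<noteq> 0"
  shows "mixed_partial js (partial j (\<lambda>\<eta>. inverse (f \<eta>))) \<theta> =
    - mixed_partial js (\<lambda>\<eta>. partial j f \<eta> * (inverse (f \<eta>) * inverse (f \<eta>))) \<theta>"
proof -
  obtain U where U: "open U" "\<theta> \<in> U" "smooth_on U f" "\<And>\<eta>. \<eta> \<in> U \<Longrightarrow> f \<eta> \<noteq> 0"
    using assms by (rule smooth_near_nonzero) blast
  have smooth: "smooth_on U (\<lambda>\<eta>. partial j f \<eta> * (inverse (f \<eta>) * inverse (f \<eta>)))"
    using U by (auto intro!: smooth_on_mult smooth_on_partial smooth_on_inverse)
  have "mixed_partial js (partial j (\<lambda>\<eta>. inverse (f \<eta>))) \<theta> =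
      mixed_partial js (\<lambda>\<eta>. - (partial j f \<eta> * (inverse (f \<eta>) * inverse (f \<eta>)))) \<theta>"
    using U by (intro mixed_partial_cong[OF U(1)]) (auto intro!: partial_inverse[OF U(1)] smooth_on_differentiable)
  also have "\<dots> = - mixed_partial js (\<lambda>\<eta>. partial j f \<eta> * (inverse (f \<eta>) * inverse (f \<eta>))) \<theta>"
    using mixed_partial_lincomb[OF U(1), of "{()}"
        "\<lambda>_ \<eta>. partial j f \<eta> * (inverse (f \<eta>) * inverse (f \<eta>))" \<theta> js "\<lambda>_. - 1"] smooth U(2) by simp
  finally show ?thesis .
qed

text \<open>Convergence of the \<open>n\<close>-jets at the single point \<theta>. No uniformity
  near \<theta> is asked for; the smoothness clauses only make the calculus rules
  applicable.\<close>

definition jets_tendsto ::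
    "nat \<Rightarrow> real^'m::finite \<Rightarrow> (nat \<Rightarrow> real^'m \<Rightarrow> real) \<Rightarrow> (real^'m \<Rightarrow> real) \<Rightarrow> bool" where
  "jets_tendsto n \<theta> f F \<longleftrightarrow> (\<forall>N. smooth_near \<theta> (f N)) \<and> smooth_near \<theta> F \<and>
    (\<forall>js. length js \<le> n \<longrightarrow> (\<lambda>N. mixed_partial js (f N) \<theta>) \<longlonglongrightarrow> mixed_partial js F \<theta>)"

lemma jets_tendsto_mono: "jets_tendsto n \<theta> f F \<Longrightarrow> k \<le> n \<Longrightarrow> jets_tendsto k \<theta> f F"
  by (auto simp: jets_tendsto_def)

lemma jets_tendsto_value: "jets_tendsto n \<theta> f F \<Longrightarrow> (\<lambda>N. f N \<theta>) \<longlonglongrightarrow> F \<theta>"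
  unfolding jets_tendsto_def by (elim conjE, drule spec[of _ "[]"]) simp

lemma jets_tendsto_partial:
  fixes f :: "nat \<Rightarrow> real^'m::finite \<Rightarrow> real"
  assumes "jets_tendsto (Suc n) \<theta> f F"
  shows "jets_tendsto n \<theta> (\<lambda>N. partial j (f N)) (partial j F)"
  unfolding jets_tendsto_def
proof (intro conjI allI impI)
  fix js :: "'m list" assume "length js \<le> n"
  then have "(\<lambda>N. mixed_partial (js @ [j]) (f N) \<theta>) \<longlonglongrightarrow> mixed_partial (js @ [j]) F \<theta>"
    using assms by (simp add: jets_tendsto_def del: mixed_partial_simps)
  then show "(\<lambda>N. mixed_partial js (partial j (f N)) \<theta>) \<longlonglongrightarrow> mixed_partial js (partial j F) \<theta>"
    by (simp add: mixed_partial_append)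
qed (use assms in \<open>auto simp: jets_tendsto_def smooth_near_partial\<close>)

lemma jets_tendsto_SucI:
  fixes f :: "nat \<Rightarrow> real^'m::finite \<Rightarrow> real"
  assumes "\<And>N. smooth_near \<theta> (f N)" "smooth_near \<theta> F" "(\<lambda>N. f N \<theta>) \<longlonglongrightarrow> F \<theta>"
    and "\<And>j js. length js \<le> n \<Longrightarrow>
      (\<lambda>N. mixed_partial js (partial j (f N)) \<theta>) \<longlonglongrightarrow> mixed_partial js (partial j F) \<theta>"
  shows "jets_tendsto (Suc n) \<theta> f F"
  unfolding jets_tendsto_def
proof (intro conjI allI impI)
  fix js :: "'m list" assume "length js \<le> Suc n"
  then show "(\<lambda>N. mixed_partial js (f N) \<theta>) \<longlonglongrightarrow> mixed_partial js F \<theta>"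
    using assms(3,4) by (cases js rule: rev_cases) (simp_all add: mixed_partial_append)
qed (use assms in auto)

text \<open>Splitting off the innermost derivative turns an order \<open>Suc n\<close> derivative of
  the product into order \<open>n\<close> derivatives of two products, whose factors have convergent
  \<open>n\<close>-jets.\<close>

lemma jets_tendsto_mult:
  fixes f :: "nat \<Rightarrow> real^'m::finite \<Rightarrow> real"
  assumes "jets_tendsto n \<theta> f F" "jets_tendsto n \<theta> g G"
  shows "jets_tendsto n \<theta> (\<lambda>N \<eta>. f N \<eta> * g N \<eta>) (\<lambda>\<eta>. F \<eta> * G \<eta>)"
  using assms
proof (induction n arbitrary: f F g G)
  case 0
  then show ?case
    using tendsto_mult[OF jets_tendsto_value[OF 0(1)] jets_tendsto_value[OF 0(2)]]
    by (simp add: jets_tendsto_def smooth_near_mult)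
next
  case (Suc n)
  have smooth: "\<And>N. smooth_near \<theta> (f N)" "smooth_near \<theta> F" "\<And>N. smooth_near \<theta> (g N)" "smooth_near \<theta> G"
    using Suc.prems by (auto simp: jets_tendsto_def)
  have n: "jets_tendsto n \<theta> f F" "jets_tendsto n \<theta> g G"
    using Suc.prems by (auto intro: jets_tendsto_mono)
  show ?case
  proof (rule jets_tendsto_SucI)
    fix j and js :: "'m list" assume len: "length js \<le> n"
    have "(\<lambda>N. mixed_partial js (\<lambda>\<eta>. partial j (f N) \<eta> * g N \<eta>) \<theta>)
        \<longlonglongrightarrow> mixed_partial js (\<lambda>\<eta>. partial j F \<eta> * G \<eta>) \<theta>"
      using Suc.IH[OF jets_tendsto_partial[OF Suc.prems(1)] n(2)] len by (simp add: jets_tendsto_def)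
    moreover have "(\<lambda>N. mixed_partial js (\<lambda>\<eta>. f N \<eta> * partial j (g N) \<eta>) \<theta>)
        \<longlonglongrightarrow> mixed_partial js (\<lambda>\<eta>. F \<eta> * partial j G \<eta>) \<theta>"
      using Suc.IH[OF n(1) jets_tendsto_partial[OF Suc.prems(2)]] len by (simp add: jets_tendsto_def)
    ultimately show "(\<lambda>N. mixed_partial js (partial j (\<lambda>\<eta>. f N \<eta> * g N \<eta>)) \<theta>)
        \<longlonglongrightarrow> mixed_partial js (partial j (\<lambda>\<eta>. F \<eta> * G \<eta>)) \<theta>"
      by (simp add: mixed_partial_partial_mult smooth tendsto_add)
  qed (use smooth n[THEN jets_tendsto_value] in \<open>auto intro!: smooth_near_mult tendsto_mult\<close>)
qed

lemma jets_tendsto_inverse: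
  fixes f :: "nat \<Rightarrow> real^'m::finite \<Rightarrow> real"
  assumes "jets_tendsto n \<theta> f F" "\<And>N. f N \<theta> \<noteq> 0" "F \<theta> \<noteq> 0"
  shows "jets_tendsto n \<theta> (\<lambda>N \<eta>. inverse (f N \<eta>)) (\<lambda>\<eta>. inverse (F \<eta>))"
  using assms(1)
proof (induction n)
  case 0
  then show ?case
    using tendsto_inverse[OF jets_tendsto_value[OF 0] assms(3)] assms(2,3)
    by (simp add: jets_tendsto_def smooth_near_inverse)
next
  case (Suc n)
  have smooth: "\<And>N. smooth_near \<theta> (f N)" "smooth_near \<theta> F"
    using Suc.prems by (auto simp: jets_tendsto_def)
  have inv: "jets_tendsto n \<theta> (\<lambda>N \<eta>. inverse (f N \<eta>)) (\<lambda>\<eta>. inverse (F \<eta>))"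
    using Suc.prems by (intro Suc.IH) (auto intro: jets_tendsto_mono)
  show ?case
  proof (rule jets_tendsto_SucI)
    fix j and js :: "'m list" assume len: "length js \<le> n"
    \<comment> \<open>The inverse occurs here only through its \<open>n\<close>-jet, which
      \<open>inv\<close> controls; multiplication adds the factor
      \<open>partial j (f N)\<close>.\<close>
    have "(\<lambda>N. mixed_partial js (\<lambda>\<eta>. partial j (f N) \<eta> * (inverse (f N \<eta>) * inverse (f N \<eta>))) \<theta>)
        \<longlonglongrightarrow> mixed_partial js (\<lambda>\<eta>. partial j F \<eta> * (inverse (F \<eta>) * inverse (F \<eta>))) \<theta>"
      using jets_tendsto_mult[OF jets_tendsto_partial[OF Suc.prems] jets_tendsto_mult[OF inv inv]] len
      by (simp add: jets_tendsto_def)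
    then show "(\<lambda>N. mixed_partial js (partial j (\<lambda>\<eta>. inverse (f N \<eta>))) \<theta>)
        \<longlonglongrightarrow> mixed_partial js (partial j (\<lambda>\<eta>. inverse (F \<eta>))) \<theta>"
      by (simp add: mixed_partial_partial_inverse smooth assms tendsto_minus)
  qed (use smooth inv[THEN jets_tendsto_value] assms in \<open>auto intro!: smooth_near_inverse\<close>)
qed

text \<open>Early denominators may vanish at \<theta>, for instance the empty average at
  \<open>N = 0\<close>. Since the limit \<open>G \<theta>\<close> is nonzero, a shift of the index
  by \<open>k\<close> removes them without changing the limit.\<close>

lemma mixed_partial_divide_tendsto:
  assumes "\<And>N. smooth_near \<theta> (f N)" "smooth_near \<theta> F" "\<And>N. smooth_near \<theta> (g N)" "smooth_near \<theta> G"
    and f: "\<And>js. (\<lambda>N. mixed_partial js (f N) \<theta>) \<longlonglongrightarrow> mixed_partial js F \<theta>"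
    and g: "\<And>js. (\<lambda>N. mixed_partial js (g N) \<theta>) \<longlonglongrightarrow> mixed_partial js G \<theta>"
    and "G \<theta> \<noteq> 0"
  shows "(\<lambda>N. mixed_partial js (\<lambda>\<eta>. f N \<eta> / g N \<eta>) \<theta>) \<longlonglongrightarrow> mixed_partial js (\<lambda>\<eta>. F \<eta> / G \<eta>) \<theta>"
proof -
  have "(\<lambda>N. g N \<theta>) \<longlonglongrightarrow> G \<theta>"
    using g[of "[]"] by simp
  then have "\<forall>\<^sub>F N in sequentially. g N \<theta> \<noteq> 0"
    using assms(7) by (rule tendsto_imp_eventually_ne)
  then obtain k where k: "g (N + k) \<theta> \<noteq> 0" for N
    unfolding eventually_sequentially by (meson le_add2)
  have "jets_tendsto n \<theta> (\<lambda>N \<eta>. f (N + k) \<eta> * inverse (g (N + k) \<eta>)) (\<lambda>\<eta>. F \<eta> * inverse (G \<eta>))" for n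
    using assms k by (intro jets_tendsto_mult jets_tendsto_inverse) (auto simp: jets_tendsto_def intro!: LIMSEQ_ignore_initial_segment)
  then have "(\<lambda>N. mixed_partial js (\<lambda>\<eta>. f (N + k) \<eta> / g (N + k) \<eta>) \<theta>)
      \<longlonglongrightarrow> mixed_partial js (\<lambda>\<eta>. F \<eta> / G \<eta>) \<theta>"
    unfolding jets_tendsto_def divide_inverse by blast
  then show ?thesis
    by (rule LIMSEQ_offset)
qed

section \<open>The Monte Carlo averages\<close>

text \<open>Exhibits the average as a finite linear combination with constant weights, so
  derivatives act on the \<open>f (s i)\<close> alone.\<close>

lemma sample_average_divide:
  "sample_average N s (\<lambda>x. f x / c x) = (\<Sum>i<N. inverse (c (s i) * real N) * f (s i))"
  unfolding sample_average_def sum_divide_distrib by (intro sum.cong) (simp_all add: divide_inverse)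

lemma smooth_on_sample_average:
  assumes "open \<Theta>" "\<And>x. smooth_on \<Theta> (f x)"
  shows "smooth_on \<Theta> (\<lambda>\<theta>. sample_average N s (\<lambda>x. f x \<theta> / c x))"
  unfolding sample_average_divide using assms by (intro smooth_on_lincomb) simp_all

text \<open>The sampling law is applied to
  \<open>mixed_partial js (f x) \<theta>0 / p x \<theta>0\<close>; the weight
  \<open>p x \<theta>0\<close> cancels in the limit. Configurations of weight 0 are lost to the
  sampling, and \<open>supp\<close> ensures that all their derivatives at \<theta>0 vanish as
  well.\<close>

lemma mc_average_mixed_partial:
  fixes f p :: "'c \<Rightarrow> real^'m::finite \<Rightarrow> real"
  assumes "open \<Theta>" "\<theta>0 \<in> \<Theta>" "\<And>x. smooth_on \<Theta> (f x)" "locally_dominated \<Theta> f"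
    and supp: "\<And>x. p x \<theta>0 \<noteq> 0 \<or> (\<forall>\<^sub>F \<theta> in nhds \<theta>0. f x \<theta> = 0)"
    and mc: "mc_sampling M X (\<lambda>x. p x \<theta>0 / Z0)"
  shows "AE \<omega> in M. \<forall>js.
    (\<lambda>N. mixed_partial js (\<lambda>\<theta>. sample_average N (\<lambda>i. X i \<omega>) (\<lambda>x. f x \<theta> / p x \<theta>0)) \<theta>0)
      \<longlonglongrightarrow> mixed_partial js (\<lambda>\<theta>. (\<Sum>\<^sub>\<infinity>x. f x \<theta>) / Z0) \<theta>0"
proof -
  have avg: "mixed_partial js (\<lambda>\<theta>. sample_average N s (\<lambda>x. f x \<theta> / p x \<theta>0)) \<theta>0
      = sample_average N s (\<lambda>x. mixed_partial js (f x) \<theta>0 / p x \<theta>0)" for js N s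
    using mixed_partial_lincomb[OF assms(1), of "{..<N}" "\<lambda>i. f (s i)" \<theta>0 js] assms(2,3)
    by (simp add: sample_average_divide)
  have lim: "mixed_partial js (\<lambda>\<theta>. (\<Sum>\<^sub>\<infinity>x. f x \<theta>) / Z0) \<theta>0
      = (\<Sum>\<^sub>\<infinity>x. p x \<theta>0 / Z0 * (mixed_partial js (f x) \<theta>0 / p x \<theta>0))"
    and summable: "(\<lambda>x. p x \<theta>0 / Z0 * (mixed_partial js (f x) \<theta>0 / p x \<theta>0)) summable_on UNIV" for js
  proof -
    \<comment> \<open>where \<open>p x \<theta>0 = 0\<close> the left-hand side is \<open>0\<close> because of \<open>a / 0 = 0\<close>, and \<open>f x\<close> vanishes near \<open>\<theta>0\<close>\<close>
    have weight: "p x \<theta>0 / Z0 * (mixed_partial js (f x) \<theta>0 / p x \<theta>0)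
        = mixed_partial js (f x) \<theta>0 * inverse Z0" for x
    proof (cases "p x \<theta>0 = 0")
      case True
      then obtain U where U: "open U" "\<theta>0 \<in> U" "\<And>\<theta>. \<theta> \<in> U \<Longrightarrow> f x \<theta> = 0"
        using supp[of x] by (auto simp: eventually_nhds)
      have "mixed_partial js (f x) \<theta>0 = mixed_partial js (\<lambda>\<theta>. 0) \<theta>0"
        using U by (intro mixed_partial_cong[of U]) auto
      also have "\<dots> = 0"
        \<comment> \<open>The zero function is the empty linear combination, so all its mixed
          partials are 0.\<close>
        using mixed_partial_lincomb[OF open_UNIV, of "{}" "\<lambda>_ _. 0" \<theta>0 js "\<lambda>_. 0"] by simp
      finally show ?thesis
        using True by simp
    qed (simp add: field_simps)
    have "mixed_partial js (\<lambda>\<theta>. (\<Sum>\<^sub>\<infinity>x. f x \<theta>) / Z0) \<theta>0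
        = mixed_partial js (\<lambda>\<theta>. \<Sum>\<^sub>\<infinity>x. f x \<theta>) \<theta>0 * inverse Z0"
      using mixed_partial_lincomb[OF assms(1), of "{()}" "\<lambda>_ \<theta>. \<Sum>\<^sub>\<infinity>x. f x \<theta>" \<theta>0 js "\<lambda>_. inverse Z0"]
        smooth_on_infsum[where f = f, OF assms(1,3,4)] assms(2) by (simp add: divide_inverse mult.commute)
    then show "mixed_partial js (\<lambda>\<theta>. (\<Sum>\<^sub>\<infinity>x. f x \<theta>) / Z0) \<theta>0
        = (\<Sum>\<^sub>\<infinity>x. p x \<theta>0 / Z0 * (mixed_partial js (f x) \<theta>0 / p x \<theta>0))"
      by (simp only: weight mixed_partial_infsum[where f = f, OF assms(1,3,4,2)] infsum_cmult_left')
    show "(\<lambda>x. p x \<theta>0 / Z0 * (mixed_partial js (f x) \<theta>0 / p x \<theta>0)) summable_on UNIV"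
      unfolding weight
      by (intro summable_on_cmult_left locally_dominated_summable[OF assms(4,2)])
  qed
  show ?thesis
    \<comment> \<open>Lists over the finite type \<open>'m\<close> are countable, so the null sets
      belonging to the individual \<open>js\<close> can be united.\<close>
    unfolding AE_all_countable avg lim
  proof
    fix js
    show "AE \<omega> in M. (\<lambda>N. sample_average N (\<lambda>i. X i \<omega>) (\<lambda>x. mixed_partial js (f x) \<theta>0 / p x \<theta>0))
        \<longlonglongrightarrow> (\<Sum>\<^sub>\<infinity>x. p x \<theta>0 / Z0 * (mixed_partial js (f x) \<theta>0 / p x \<theta>0))"
      using mc[unfolded mc_sampling_def mc_exact_def, THEN conjunct2, THEN conjunct2,
          THEN spec, THEN mp, OF summable[of js]] .
  qed
qed

section \<open>The estimator, the mean value and their derivatives of every order\<close>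

lemma mc_estimator_eq:
  "mc_estimator p Q N s \<phi> = (\<lambda>\<theta>.
    sample_average N s (\<lambda>x. p x \<theta> * Q x \<theta> / p x \<phi>) / sample_average N s (\<lambda>x. p x \<theta> / p x \<phi>))"
  by (simp add: mc_estimator_def detached_ratio_def plain_def detach_def)

lemma mean_value_eq: "mean_value p Q \<theta> = (\<Sum>\<^sub>\<infinity>x. p x \<theta> * Q x \<theta>) / partition_function p \<theta>"
  by (simp add: mean_value_def divide_inverse infsum_cmult_left')

text \<open>Since \<open>deriv\<close> is total, convergence of \<open>nabla\<close> alone would not
  express differentiability; the first two clauses supply it. A multi-index \<open>n\<close> is
  represented by every list with these multiplicities, so the order of differentiation is
  free.\<close>

theorem theorem2:
  fixes p Q :: "'c \<Rightarrow> real^'m::finite \<Rightarrow> real"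
    and \<Theta> :: "(real^'m) set" and \<theta>0 :: "real^'m"
    and M :: "'w measure" and X :: "nat \<Rightarrow> 'w \<Rightarrow> 'c"
  assumes "open \<Theta>" and "\<theta>0 \<in> \<Theta>"
    and "\<And>x \<theta>. \<theta> \<in> \<Theta> \<Longrightarrow> p x \<theta> \<ge> 0"
    and "\<And>\<theta>. \<theta> \<in> \<Theta> \<Longrightarrow> partition_function p \<theta> > 0"
    and "\<And>x. smooth_on \<Theta> (p x)" and "\<And>x. smooth_on \<Theta> (Q x)"
    and "locally_dominated \<Theta> p" and "locally_dominated \<Theta> (\<lambda>x \<theta>. p x \<theta> * Q x \<theta>)"
    and "\<And>x. p x \<theta>0 > 0 \<or> (\<forall>\<^sub>F \<theta> in nhds \<theta>0. p x \<theta> = 0)"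
    and "mc_sampling M X (\<lambda>x. p x \<theta>0 / partition_function p \<theta>0)"
  shows "smooth_on \<Theta> (mean_value p Q) \<and>
    (\<forall>N s. (\<exists>i<N. p (s i) \<theta>0 > 0) \<longrightarrow>
       (\<exists>U. open U \<and> \<theta>0 \<in> U \<and> smooth_on U (mc_estimator p Q N s \<theta>0))) \<and>
    (\<forall>n js. (\<forall>j. count_list js j = n j) \<longrightarrow>
       mc_exact M
         (\<lambda>N \<omega>. detach (nabla js (mc_estimator p Q N (\<lambda>i. X i \<omega>))) \<theta>0 \<theta>0)
         (detach (nabla js (plain (mean_value p Q))) \<theta>0 \<theta>0))"
proof (intro conjI allI impI)
  let ?f = "\<lambda>x \<theta>. p x \<theta> * Q x \<theta>" and ?Z = "partition_function p"
  define Z0 where "Z0 = ?Z \<theta>0"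
  note \<Theta> = assms(1,2)
  have Z0: "Z0 > 0"
    using assms(2,4) by (simp add: Z0_def)
  have smooth_f: "smooth_on \<Theta> (?f x)" for x
    using assms(1,5,6) by (intro smooth_on_mult)
  have smooth_Z: "smooth_on \<Theta> ?Z"
    unfolding partition_function_def using assms(1,5,7) by (intro smooth_on_infsum)
  have smooth_F: "smooth_on \<Theta> (\<lambda>\<theta>. \<Sum>\<^sub>\<infinity>x. ?f x \<theta>)"
    using assms(1) smooth_f assms(8) by (intro smooth_on_infsum)
  have nz: "\<And>\<theta>. \<theta> \<in> \<Theta> \<Longrightarrow> ?Z \<theta> \<noteq> 0"
    using assms(4) by fastforce
  have smooth_ratio: "smooth_near \<theta>0 (\<lambda>\<theta>. g \<theta> / Z0)" if "smooth_on \<Theta> g" for g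
    using smooth_on_lincomb[OF assms(1), of "{()}" "\<lambda>_. g" "\<lambda>_. inverse Z0"] that
    by (intro smooth_nearI[OF \<Theta>]) (simp add: divide_inverse mult.commute)
  have smooth_avg: "smooth_near \<theta>0 (\<lambda>\<theta>. sample_average N s (\<lambda>x. g x \<theta> / p x \<theta>0))"
    if "\<And>x. smooth_on \<Theta> (g x)" for N s and g :: "'c \<Rightarrow> real^'m \<Rightarrow> real"
    using assms(1) that by (intro smooth_nearI[OF \<Theta>] smooth_on_sample_average)
  show "smooth_on \<Theta> (mean_value p Q)"
    unfolding mean_value_eq divide_inverse
    using assms(1) smooth_F smooth_Z nz by (intro smooth_on_mult smooth_on_inverse)
  show "\<exists>U. open U \<and> \<theta>0 \<in> U \<and> smooth_on U (mc_estimator p Q N s \<theta>0)"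
    if pos: "\<exists>i<N. p (s i) \<theta>0 > 0" for N s
  proof -
    obtain i where i: "i < N" "p (s i) \<theta>0 > 0"
      using pos by blast
    \<comment> \<open>Each summand is 1 or, where the weight vanishes, \<open>0 / 0 = 0\<close>; the
      chosen \<open>i\<close> contributes a 1. Hence the denominator of the estimator is nonzero at
      \<theta>0.\<close>
    have "0 < (\<Sum>i<N. p (s i) \<theta>0 / p (s i) \<theta>0)"
      using i by (intro sum_pos2[of _ i]) auto
    then have "sample_average N s (\<lambda>x. p x \<theta>0 / p x \<theta>0) \<noteq> 0"
      using i by (auto simp: sample_average_def)
    moreover have "smooth_near \<theta>0 (\<lambda>\<theta>. sample_average N s (\<lambda>x. p x \<theta> / p x \<theta>0))"
      "smooth_near \<theta>0 (\<lambda>\<theta>. sample_average N s (\<lambda>x. ?f x \<theta> / p x \<theta>0))"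
      by (rule smooth_avg smooth_f assms(5))+
    ultimately have "smooth_near \<theta>0 (mc_estimator p Q N s \<theta>0)"
      unfolding mc_estimator_eq divide_inverse[of "sample_average _ _ _"]
      by (intro smooth_near_mult smooth_near_inverse)
    then show ?thesis
      by (simp add: smooth_near_def)
  qed
  fix n :: "'m \<Rightarrow> nat" and js :: "'m list"
  have supp: "p x \<theta>0 \<noteq> 0 \<or> (\<forall>\<^sub>F \<theta> in nhds \<theta>0. p x \<theta> = 0)" for x
    using assms(9)[of x] by auto
  have supp_f: "p x \<theta>0 \<noteq> 0 \<or> (\<forall>\<^sub>F \<theta> in nhds \<theta>0. ?f x \<theta> = 0)" for x
    using supp[of x] by (auto elim: eventually_mono)
  \<comment> \<open>The constant \<open>Z0\<close> is inserted above and below, so that numerator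
    and denominator become the limits of the two sample averages.\<close>
  have mean: "mixed_partial js (mean_value p Q) \<theta>0
      = mixed_partial js (\<lambda>\<theta>. (\<Sum>\<^sub>\<infinity>x. ?f x \<theta>) / Z0 / ((\<Sum>\<^sub>\<infinity>x. p x \<theta>) / Z0)) \<theta>0"
    using Z0 by (intro mixed_partial_cong[OF assms(1) _ assms(2)])
      (simp add: mean_value_eq partition_function_def)
  note mc = assms(10)[folded Z0_def]
  have "AE \<omega> in M. (\<lambda>N. mixed_partial js (mc_estimator p Q N (\<lambda>i. X i \<omega>) \<theta>0) \<theta>0)
      \<longlonglongrightarrow> mixed_partial js (mean_value p Q) \<theta>0"
    using mc_average_mixed_partial[where f = ?f and p = p, OF \<Theta> smooth_f assms(8) supp_f mc]
      mc_average_mixed_partial[where f = p and p = p, OF \<Theta> assms(5,7) supp mc]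
  proof eventually_elim
    case (elim \<omega>)
    show ?case
      unfolding mc_estimator_eq mean
    proof (rule mixed_partial_divide_tendsto)
      show "smooth_near \<theta>0 (\<lambda>\<theta>. sample_average N (\<lambda>i. X i \<omega>) (\<lambda>x. ?f x \<theta> / p x \<theta>0))"
        "smooth_near \<theta>0 (\<lambda>\<theta>. sample_average N (\<lambda>i. X i \<omega>) (\<lambda>x. p x \<theta> / p x \<theta>0))" for N
        by (rule smooth_avg smooth_f assms(5))+
      show "smooth_near \<theta>0 (\<lambda>\<theta>. (\<Sum>\<^sub>\<infinity>x. ?f x \<theta>) / Z0)"
        by (rule smooth_ratio[OF smooth_F])
      show "smooth_near \<theta>0 (\<lambda>\<theta>. (\<Sum>\<^sub>\<infinity>x. p x \<theta>) / Z0)"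
        by (rule smooth_ratio[OF smooth_Z[unfolded partition_function_def]])
      show "(\<Sum>\<^sub>\<infinity>x. p x \<theta>0) / Z0 \<noteq> 0"
        using Z0 by (simp add: Z0_def partition_function_def)
    qed (rule elim[rule_format])+
  qed
  \<comment> \<open>\<open>nabla\<close> differentiates in the second argument with the first frozen
    at \<theta>0, and \<open>detach\<close> then reads off the diagonal, which is exactly the mixed
    partial at \<theta>0 treated above.\<close>
  then show "mc_exact M
      (\<lambda>N \<omega>. detach (nabla js (mc_estimator p Q N (\<lambda>i. X i \<omega>))) \<theta>0 \<theta>0)
      (detach (nabla js (plain (mean_value p Q))) \<theta>0 \<theta>0)"
    by (simp add: mc_exact_def detach_def nabla_def plain_def)
qed

end
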